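(* Let $n_{C_1},n_{C_2}\geq1$ be integers with $n_{C_1}+n_{C_2}=n_C$. Then for the system $\dot{\mathbf x}=\tilde F(\mathbf x,g):=-\mathbf x+\frac{1}{\sqrt N}\tilde H\tanh(g\mathbf x)$ on $\mathbb R^{n_C+n_I}$, at the bifurcation point $$(\mathbf x,g)=(\mathbf 0,g_C),\qquad g_C:=\frac{\sqrt N}{(p-1)n_C\,\mu},$$ and for every division of the $n_C$ excitatory clusters into two groups of sizes $n_{C_1}$ and $n_{C_2}$, there emerges a smooth branch of equilibria with isotropy subgroup $\Sigma_C=S_{n_{C_1}}\times S_{n_{C_2}}\times S_{n_I}$. That is, there is a smooth curve $s\mapsto(\mathbf x(s),g(s))$, defined for $|s|$ small, with $\mathbf x(0)=\mathbf 0$, $g(0)=g_C$, $\mathbf x'(0)\ne\mathbf 0$ and $\tilde F(\mathbf x(s),g(s))=\mathbf 0$, such that for $s\neq0$ the solution $\mathbf x(s)$ takes one common value $x_{E_1}$ on the first group of excitatory clusters, a different common value $x_{E_2}\ne x_{E_1}$ on the second group, and a common value $x_I$ on all inhibitory cells.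
   Context: Let $n_C\ge2$, $n_I\ge1$ and $p>1$ be integers, $n_E=p\,n_C$, $N=n_E+n_I$, $f=n_E/N$, $\alpha=\frac{f}{1-f}$ (so $\alpha n_I=p n_C$), with $n_C\ge\alpha$, and let $\mu>0$. The function $\tanh$ acts on vectors componentwise. $\mathbf 1_{m\times n}$ is the all-ones matrix and $\mathbf K_n=\mathbf 1_{n\times n}-\mathbf I_n$, with $\mathbf I_n$ the identity. The reduced connectivity matrix is $$\tilde H=\begin{bmatrix}(p-1)n_C\,\mu\,\mathbf I_{n_C} & -\alpha\mu\,\mathbf 1_{n_C\times n_I}\\ p\,\mu\,\mathbf 1_{n_I\times n_C} & -\alpha\mu\,\mathbf K_{n_I}\end{bmatrix}.$$ The first $n_C$ coordinates are the activities of the excitatory clusters, the last $n_I$ the activities of the inhibitory cells. The system is equivariant under $\Gamma=S_{n_C}\times S_{n_I}$, acting by permuting the first $n_C$ and the last $n_I$ coordinates. The isotropy subgroup of $\mathbf x$ is $\{\gamma\in\Gamma:\gamma\mathbf x=\mathbf x\}$; $S_{n_{C_1}}\times S_{n_{C_2}}\times S_{n_I}$ denotes the subgroup of $\Gamma$ preserving the two chosen groups of excitatory clusters. *)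

theory Defs
  imports "HOL-Analysis.Analysis"
begin

text \<open>
  The state space \<open>\<real>\<^bsup>n_C + n_I\<^esup>\<close> is rendered as \<open>real ^ ('c + 'i)\<close> with \<open>n_C = CARD('c)\<close> and
  \<open>n_I = CARD('i)\<close>: \<open>Inl\<close> indexes the excitatory clusters, \<open>Inr\<close> the inhibitory cells.
\<close>

definition ones_mat :: "real ^ 'n ^ 'm"
  where "ones_mat = (\<chi> i j. 1)"

definition K_mat :: "real ^ 'n ^ 'n"
  where "K_mat = ones_mat - mat 1"

definition block_mat ::
  "real ^ 'c ^ 'c \<Rightarrow> real ^ 'i ^ 'c \<Rightarrow> real ^ 'c ^ 'i \<Rightarrow> real ^ 'i ^ 'i
     \<Rightarrow> real ^ ('c::finite + 'i::finite) ^ ('c + 'i)"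
  where "block_mat A B C D =
    (\<chi> a b. case a of
        Inl i \<Rightarrow> (case b of Inl j \<Rightarrow> A $ i $ j | Inr j \<Rightarrow> B $ i $ j)
      | Inr i \<Rightarrow> (case b of Inl j \<Rightarrow> C $ i $ j | Inr j \<Rightarrow> D $ i $ j))"

definition H_tilde :: "nat \<Rightarrow> real \<Rightarrow> real \<Rightarrow> real ^ ('c::finite + 'i::finite) ^ ('c + 'i)"
  where "H_tilde p \<alpha> \<mu> =
    block_mat (((real p - 1) * real CARD('c) * \<mu>) *\<^sub>R mat 1) ((- \<alpha> * \<mu>) *\<^sub>R ones_mat)
              ((real p * \<mu>) *\<^sub>R ones_mat)                      ((- \<alpha> * \<mu>) *\<^sub>R K_mat)"

definition tanh_vec :: "real ^ 'n \<Rightarrow> real ^ 'n"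
  where "tanh_vec v = (\<chi> a. tanh (v $ a))"

definition F_tilde ::
  "nat \<Rightarrow> real \<Rightarrow> real \<Rightarrow> nat \<Rightarrow> real ^ ('c::finite + 'i::finite) \<Rightarrow> real \<Rightarrow> real ^ ('c + 'i)"
  where "F_tilde p \<alpha> \<mu> N x g =
    - x + (1 / sqrt (real N)) *\<^sub>R (H_tilde p \<alpha> \<mu> *v tanh_vec (g *\<^sub>R x))"

definition Gamma :: "(('c::finite \<Rightarrow> 'c) \<times> ('i::finite \<Rightarrow> 'i)) set"
  where "Gamma = {\<sigma>. \<sigma> permutes UNIV} \<times> {\<tau>. \<tau> permutes UNIV}"

text \<open>The inverses make this a left action: the entry at position \<open>i\<close> is moved to \<open>\<sigma> i\<close>.\<close>

definition Gamma_act ::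
  "('c \<Rightarrow> 'c) \<times> ('i \<Rightarrow> 'i) \<Rightarrow> real ^ ('c::finite + 'i::finite) \<Rightarrow> real ^ ('c + 'i)"
  where "Gamma_act \<gamma> x =
    (\<chi> a. case a of Inl i \<Rightarrow> x $ Inl (inv (fst \<gamma>) i) | Inr j \<Rightarrow> x $ Inr (inv (snd \<gamma>) j))"

definition isotropy_subgroup ::
  "real ^ ('c::finite + 'i::finite) \<Rightarrow> (('c \<Rightarrow> 'c) \<times> ('i \<Rightarrow> 'i)) set"
  where "isotropy_subgroup x = {\<gamma> \<in> Gamma. Gamma_act \<gamma> x = x}"

text \<open>
  For \<open>{C1, C2}\<close> a partition of the clusters this is the copy of
  \<open>S_{card C1} \<times> S_{card C2} \<times> S_{n_I}\<close> inside \<open>\<Gamma>\<close> (each of the two groups is mapped to itself,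
  so they are not swapped even when they have equal size).
\<close>

definition Sigma_C :: "'c set \<Rightarrow> 'c set \<Rightarrow> (('c::finite \<Rightarrow> 'c) \<times> ('i::finite \<Rightarrow> 'i)) set"
  where "Sigma_C C1 C2 = {\<gamma> \<in> Gamma. fst \<gamma> ` C1 = C1 \<and> fst \<gamma> ` C2 = C2}"

text \<open>\<open>C\<^sup>\<infinity>\<close> on \<open>S\<close> (meant for open \<open>S\<close>); \<open>D k\<close> is the \<open>k\<close>-th derivative of the curve.\<close>

definition smooth_curve_on :: "real set \<Rightarrow> (real \<Rightarrow> 'a::real_normed_vector) \<Rightarrow> bool"
  where "smooth_curve_on S c \<longleftrightarrow>
    (\<exists>D :: nat \<Rightarrow> real \<Rightarrow> 'a. D 0 = c \<and>
       (\<forall>k. \<forall>s\<in>S. (D k has_vector_derivative D (Suc k) s) (at s)))"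

end

theory Submission
  imports Defs "HOL-Complex_Analysis.Cauchy_Integral_Formula"
begin

text \<open>
  With \<open>u = g x_E1\<close>, \<open>v = g x_E2\<close>, \<open>w = g x_I\<close>, \<open>\<beta> = p / (p - 1)\<close>, \<open>\<nu>1 = n_C1 / n_C\<close>,
  \<open>\<nu>2 = n_C2 / n_C\<close> and \<open>\<rho> = g_C / g\<close>, two-cluster equilibria are the solutions of
  \<open>\<rho> u = tanh u - \<beta> tanh w\<close>, \<open>\<rho> v = tanh v - \<beta> tanh w\<close> and
  \<open>\<rho> w = \<beta> (\<nu>1 tanh u + \<nu>2 tanh v) - \<beta> (1 - 1 / n_I) tanh w\<close>.
  Blowing up by \<open>u = s\<close>, \<open>v = s t\<close>, the first two equations give \<open>\<rho>\<close> and \<open>w\<close> explicitly as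
  analytic functions of \<open>(s, t)\<close> for \<open>t \<noteq> 1\<close>. Divided by \<open>s\<close>, the third one becomes a fixed-point
  equation \<open>t = P(s, t)\<close> with \<open>P(0, t) = - \<nu>1 / \<nu>2\<close> constant in \<open>t\<close>, so \<open>P(s, _)\<close> is a contraction
  for small complex \<open>s\<close>. Its Picard iterates are holomorphic in \<open>s\<close> and converge uniformly, hence
  \<open>t\<close> is holomorphic in \<open>s\<close>; it is real for real \<open>s\<close>, and \<open>C\<^sup>\<infinity>\<close> smoothness comes for free.
\<close>

section \<open>Fixed points of holomorphic maps depending on a parameter\<close>

text \<open>Cauchy's estimate on discs of radius \<open>r / 4\<close> about points of the half disc,
  which stay inside the large disc: since all values lie within \<open>r / 8\<close> of
  \<open>t0\<close>, the derivative is at most \<open>(r / 8) / (r / 4) = 1 / 2\<close>. Convexity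
  of the half disc turns this into a Lipschitz bound.\<close>

lemma holomorphic_lipschitz_half:
  fixes f :: "complex \<Rightarrow> complex"
  assumes "r > 0" and holo: "f holomorphic_on ball t0 r"
    and bound: "\<And>t. t \<in> ball t0 r \<Longrightarrow> f t \<in> ball t0 (r / 8)"
    and "x \<in> cball t0 (r / 2)" "y \<in> cball t0 (r / 2)"
  shows "dist (f x) (f y) \<le> 1 / 2 * dist x y"
  unfolding dist_norm
proof (rule field_differentiable_bound[where S = "cball t0 (r / 2)" and f' = "deriv f"])
  fix z assume z: "z \<in> cball t0 (r / 2)"
  have sub: "cball z (r / 4) \<subseteq> ball t0 r"
  proof
    fix w assume "w \<in> cball z (r / 4)"
    then show "w \<in> ball t0 r"
      using z dist_triangle[of t0 w z] \<open>r > 0\<close> by simp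
  qed
  then have zin: "z \<in> ball t0 r" using \<open>r > 0\<close> by (meson centre_in_cball divide_nonneg_pos less_imp_le subsetD zero_less_numeral)
  show "(f has_field_derivative deriv f z) (at z within cball t0 (r / 2))"
    using holomorphic_derivI[OF holo open_ball zin] by (rule has_field_derivative_at_within)
  have "cmod ((deriv ^^ 1) f z) \<le> fact 1 * (r / 8) / (r / 4) ^ 1"
  proof (rule Cauchy_higher_deriv_bound[where y = t0])
    show "f holomorphic_on ball z (r / 4)"
      using holo sub by (meson ball_subset_cball holomorphic_on_subset order_trans)
    show "continuous_on (cball z (r / 4)) f"
      using holo sub by (meson continuous_on_subset holomorphic_on_imp_continuous_on)
    show "\<And>w. w \<in> ball z (r / 4) \<Longrightarrow> f w \<in> ball t0 (r / 8)"
      using sub bound by (meson ball_subset_cball subsetD)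
  qed (use \<open>r > 0\<close> in auto)
  then show "cmod (deriv f z) \<le> 1 / 2" using \<open>r > 0\<close> by simp
qed (use assms in auto)

text \<open>Hypothesis \<open>comp\<close> replaces holomorphy in two variables: it is exactly what
  makes each Picard iterate, started at the constant \<open>t0\<close>, holomorphic in the
  parameter. If \<open>t0\<close> is real and \<open>P s\<close> preserves real points, the iterates
  are real, and so is their limit.\<close>

lemma holomorphic_fixed_point:
  fixes P :: "complex \<Rightarrow> complex \<Rightarrow> complex"
  assumes "r > 0" "open S"
    and bound: "\<And>s t. s \<in> S \<Longrightarrow> t \<in> ball t0 r \<Longrightarrow> P s t \<in> ball t0 (r / 8)"
    and holt: "\<And>s. s \<in> S \<Longrightarrow> P s holomorphic_on ball t0 r"
    and comp: "\<And>\<phi>. \<phi> holomorphic_on S \<Longrightarrow> \<phi> ` S \<subseteq> ball t0 r \<Longrightarrow>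
                  (\<lambda>s. P s (\<phi> s)) holomorphic_on S"
  obtains \<phi> where "\<phi> holomorphic_on S" "\<phi> ` S \<subseteq> ball t0 r"
    "\<And>s. s \<in> S \<Longrightarrow> P s (\<phi> s) = \<phi> s"
    "\<And>s. s \<in> S \<Longrightarrow> t0 \<in> \<real> \<Longrightarrow> (\<And>t. t \<in> \<real> \<inter> ball t0 r \<Longrightarrow> P s t \<in> \<real>) \<Longrightarrow> \<phi> s \<in> \<real>"
proof -
  let ?C = "cball t0 (r / 2)"
  have C_sub: "?C \<subseteq> ball t0 r" using \<open>r > 0\<close> by auto
  have self: "P s t \<in> ?C" if "s \<in> S" "t \<in> ?C" for s t
    using bound[OF that(1), of t] that(2) C_sub \<open>r > 0\<close> by auto
  have lip: "dist (P s x) (P s y) \<le> 1 / 2 * dist x y" if "s \<in> S" "x \<in> ?C" "y \<in> ?C" for s x y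
    using holomorphic_lipschitz_half[OF \<open>r > 0\<close> holt[OF that(1)] bound[OF that(1)] that(2,3)] .
  have "\<exists>t\<in>?C. P s t = t" if "s \<in> S" for s
  proof -
    have "\<exists>!t\<in>?C. P s t = t"
      by (rule Banach_fix[where c = "1 / 2"])
        (use \<open>r > 0\<close> self[OF that] lip[OF that] in \<open>auto simp: complete_eq_closed\<close>)
    then show ?thesis by blast
  qed
  then obtain \<phi> where \<phi>: "\<And>s. s \<in> S \<Longrightarrow> \<phi> s \<in> ?C" "\<And>s. s \<in> S \<Longrightarrow> P s (\<phi> s) = \<phi> s"
    by metis
  define X where "X n s = (P s ^^ n) t0" for n s
  have X_Suc: "X (Suc n) s = P s (X n s)" for n s by (simp add: X_def)
  have X_C: "X n s \<in> ?C" if "s \<in> S" for n s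
    by (induction n) (use \<open>r > 0\<close> self[OF that] in \<open>auto simp: X_def\<close>)
  \<comment> \<open>The bound does not depend on \<open>s\<close>, which is what makes the
    convergence uniform on \<open>S\<close>.\<close>
  have X_dist: "dist (X n s) (\<phi> s) \<le> (1 / 2) ^ n * r" if "s \<in> S" for n s
  proof (induction n)
    case 0
    then show ?case using \<phi>(1)[OF that] \<open>r > 0\<close> by (simp add: X_def)
  next
    case (Suc n)
    have "dist (X (Suc n) s) (\<phi> s) \<le> 1 / 2 * dist (X n s) (\<phi> s)"
      using lip[OF that X_C[OF that] \<phi>(1)[OF that], of n] by (simp add: X_Suc \<phi>(2)[OF that])
    with Suc show ?case by simp
  qed
  have null: "(\<lambda>n. (1 / 2) ^ n * r) \<longlonglongrightarrow> 0"
    by (rule tendsto_mult_left_zero) (simp add: LIMSEQ_realpow_zero)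
  have ulim: "uniform_limit S X \<phi> sequentially"
  proof (rule uniform_limitI)
    fix e :: real assume "e > 0"
    with null have "\<forall>\<^sub>F n in sequentially. (1 / 2) ^ n * r < e"
      by (rule order_tendstoD)
    then show "\<forall>\<^sub>F n in sequentially. \<forall>s\<in>S. dist (X n s) (\<phi> s) < e"
      by eventually_elim (use X_dist in \<open>meson order.strict_trans1\<close>)
  qed
  have X_hol: "X n holomorphic_on S" for n
  proof (induction n)
    case 0
    then show ?case by (simp add: X_def)
  next
    case (Suc n)
    have "X n ` S \<subseteq> ball t0 r" using X_C C_sub by blast
    then show ?case using comp[OF Suc] by (simp add: X_Suc[abs_def])
  qed
  show ?thesis
  proof
    show "\<phi> holomorphic_on S"
    proof (rule holomorphic_uniform_sequence[OF \<open>open S\<close>])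
      show "X n holomorphic_on S" for n by (rule X_hol)
      show "\<exists>d>0. cball x d \<subseteq> S \<and> uniform_limit (cball x d) X \<phi> sequentially" if "x \<in> S" for x
        using that \<open>open S\<close> ulim by (meson open_contains_cball uniform_limit_on_subset)
    qed
    show "\<phi> ` S \<subseteq> ball t0 r" using \<phi>(1) C_sub by blast
    show "P s (\<phi> s) = \<phi> s" if "s \<in> S" for s by (rule \<phi>(2)[OF that])
  next
    fix s assume s: "s \<in> S" and t0: "t0 \<in> \<real>"
      and P_real: "\<And>t. t \<in> \<real> \<inter> ball t0 r \<Longrightarrow> P s t \<in> \<real>"
    have "X n s \<in> \<real>" for n
    proof (induction n)
      case 0
      then show ?case using t0 by (simp add: X_def)
    next
      case (Suc n)
      then show ?case using P_real X_C[OF s, of n] C_sub unfolding X_Suc by blast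
    qed
    moreover have "(\<lambda>n. X n s) \<longlonglongrightarrow> \<phi> s"
      using ulim s by (rule tendsto_uniform_limitI)
    ultimately show "\<phi> s \<in> \<real>"
      by (rule closed_sequentially[OF closed_complex_Reals])
  qed
qed

section \<open>The quotients tanh z / z and artanh z / z\<close>

text \<open>\<open>tanhc\<close> and \<open>artanhc\<close> let a factor \<open>s\<close> be
  cancelled from the equilibrium equations without losing \<open>s = 0\<close>. They are polymorphic
  so that the same formulas serve over the reals and over the complex numbers.\<close>

definition tanhc :: "'a::{real_normed_field, banach} \<Rightarrow> 'a"
  where "tanhc z = (if z = 0 then 1 else tanh z / z)"

definition artanhc :: "'a::{real_normed_field, banach, ln} \<Rightarrow> 'a"
  where "artanhc z = (if z = 0 then 1 else artanh z / z)"

lemma tanhc_0 [simp]: "tanhc 0 = 1" and artanhc_0 [simp]: "artanhc 0 = 1"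
  by (simp_all add: tanhc_def artanhc_def)

lemma mult_tanhc: "z * tanhc z = tanh z" and mult_artanhc: "z * artanhc z = artanh z"
  by (simp_all add: tanhc_def artanhc_def)

text \<open>The zeros of \<open>cosh\<close> are the odd multiples of \<open>\<i> * pi / 2\<close>,
  of modulus at least \<open>pi / 2 > 1\<close>.\<close>

lemma cosh_nonzero_ball:
  fixes z :: complex
  assumes "z \<in> ball 0 1"
  shows "cosh z \<noteq> 0"
proof
  assume "cosh z = 0"
  then have "cos (\<i> * z) = 0" by (simp add: cosh_conv_cos)
  then obtain n :: int where n: "\<i> * z = of_real (of_int n * pi) + of_real pi / 2"
    by (auto simp: cos_eq_0)
  have "norm z = norm (\<i> * z)" by (simp add: norm_mult)
  also have "\<i> * z = of_real ((of_int n + 1 / 2) * pi)" by (simp add: n algebra_simps)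
  also have "norm \<dots> = \<bar>of_int n + 1 / 2\<bar> * pi" by (simp only: norm_of_real abs_mult) simp
  also have "\<dots> \<ge> 1 / 2 * pi"
  proof (rule mult_right_mono)
    have "n \<ge> 0 \<or> n \<le> -1" by linarith
    then have "real_of_int n \<ge> 0 \<or> real_of_int n \<le> -1" by linarith
    then show "1 / 2 \<le> \<bar>real_of_int n + 1 / 2\<bar>" by linarith
  qed simp
  finally show False using assms pi_gt3 by simp
qed

text \<open>\<open>tanhc\<close> is the difference quotient of \<open>tanh\<close> at 0, completed
  by the derivative 1 there; the singularity is removable.\<close>

lemma holomorphic_tanhc: "tanhc holomorphic_on ball (0 :: complex) 1"
proof -
  have "(tanh has_field_derivative 1 - tanh z ^ 2) (at z)" if "z \<in> ball (0 :: complex) 1" for z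
    using cosh_nonzero_ball[OF that] by (auto intro!: derivative_eq_intros)
  note tanh_deriv = this
  have "tanh holomorphic_on ball (0 :: complex) 1"
    using tanh_deriv by (meson holomorphic_on_open open_ball)
  moreover have "deriv tanh (0 :: complex) = 1"
    using tanh_deriv[of 0] by (auto intro: DERIV_imp_deriv)
  ultimately have "(\<lambda>z. if z = 0 then 1 else (tanh z - tanh 0) / (z - 0)) holomorphic_on ball (0 :: complex) 1"
    using pole_lemma_open[of tanh "ball 0 1" 0] by (simp cong: if_cong)
  then show ?thesis by (simp add: tanhc_def[abs_def] cong: if_cong)
qed

text \<open>The real part equals (1 - |z|^2) / |1 - z|^2. This keeps the logarithm inside
  \<open>artanh\<close> away from its branch cut.\<close>

lemma Re_artanh_arg_pos:
  fixes z :: complex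
  assumes "z \<in> ball 0 1"
  shows "Re ((1 + z) / (1 - z)) > 0"
proof -
  have z: "norm z < 1" using assms by simp
  then have "(Re z)\<^sup>2 + (Im z)\<^sup>2 < 1"
    using cmod_power2[of z] by (smt (verit) norm_ge_zero power_le_one_iff power2_eq_1_iff)
  moreover have "(cmod (1 - z))\<^sup>2 > 0" using z by auto
  ultimately show ?thesis
    unfolding cmod_power2
    by (simp add: Re_divide power2_eq_square algebra_simps zero_less_divide_iff zero_less_mult_iff)
qed

lemma holomorphic_artanhc: "artanhc holomorphic_on ball (0 :: complex) 1"
proof -
  have artanh_deriv: "(artanh has_field_derivative 1 / (1 - z\<^sup>2)) (at z)" if "z \<in> ball (0 :: complex) 1" for z
  proof -
    have "(1 + z) / (1 - z) \<notin> \<real>\<^sub>\<le>\<^sub>0" 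
      using Re_artanh_arg_pos[OF that] by (auto simp: complex_nonpos_Reals_iff)
    moreover have "1 - z \<noteq> 0" "1 + z \<noteq> 0" "1 - z\<^sup>2 \<noteq> 0"
      using that by (auto simp: add_eq_0_iff power2_eq_1_iff)
    ultimately show ?thesis
      unfolding artanh_def[abs_def]
      by (auto intro!: derivative_eq_intros simp: divide_simps power2_eq_square) (auto simp: algebra_simps)
  qed
  have "artanh holomorphic_on ball (0 :: complex) 1"
    using artanh_deriv by (meson holomorphic_on_open open_ball)
  moreover have "deriv artanh (0 :: complex) = 1"
    using artanh_deriv[of 0] by (auto intro: DERIV_imp_deriv)
  ultimately have "(\<lambda>z. if z = 0 then 1 else (artanh z - artanh 0) / (z - 0)) holomorphic_on ball (0 :: complex) 1"
    using pole_lemma_open[of artanh "ball 0 1" 0] by (simp cong: if_cong)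
  then show ?thesis by (simp add: artanhc_def[abs_def] cong: if_cong)
qed

lemma tanhc_of_real: "tanhc (of_real x :: complex) = of_real (tanhc x)"
  by (simp add: tanhc_def tanh_altdef flip: exp_of_real of_real_minus)

lemma artanhc_of_real:
  assumes "\<bar>x\<bar> < 1"
  shows "artanhc (of_real x :: complex) = of_real (artanhc x)"
proof -
  have "(1 + x) / (1 - x) > 0" using assms by simp
  then have "Ln (of_real ((1 + x) / (1 - x))) = of_real (ln ((1 + x) / (1 - x)))" by (rule Ln_of_real)
  then show ?thesis by (simp add: artanhc_def artanh_def)
qed

lemma tanh_artanh_real:
  fixes x :: real
  assumes "\<bar>x\<bar> < 1"
  shows "tanh (artanh x) = x"
proof -
  have "(1 + x) / (1 - x) > 0" using assms by simp
  then have "exp (- 2 * artanh x) = (1 - x) / (1 + x)"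
    by (simp add: artanh_def exp_minus)
  then show ?thesis using assms by (simp only: tanh_real_altdef) (simp add: field_simps)
qed


text \<open>The domain is an arbitrary topological space because the rule is applied to functions of
  the pair \<open>(s, t)\<close>.\<close>

lemma continuous_on_tanhc' [continuous_intros]:
  fixes h :: "'a::topological_space \<Rightarrow> complex"
  assumes "continuous_on S h" "\<And>z. z \<in> S \<Longrightarrow> h z \<in> ball 0 1"
  shows "continuous_on S (\<lambda>z. tanhc (h z))"
  by (rule continuous_on_compose2[OF holomorphic_on_imp_continuous_on[OF holomorphic_tanhc]])
    (use assms in auto)

lemma continuous_on_artanhc' [continuous_intros]:
  fixes h :: "'a::topological_space \<Rightarrow> complex"
  assumes "continuous_on S h" "\<And>z. z \<in> S \<Longrightarrow> h z \<in> ball 0 1"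
  shows "continuous_on S (\<lambda>z. artanhc (h z))"
  by (rule continuous_on_compose2[OF holomorphic_on_imp_continuous_on[OF holomorphic_artanhc]])
    (use assms in auto)

lemma holomorphic_on_tanhc' [holomorphic_intros]:
  assumes "h holomorphic_on S" "\<And>z. z \<in> S \<Longrightarrow> h z \<in> ball 0 1"
  shows "(\<lambda>z. tanhc (h z)) holomorphic_on S"
  using holomorphic_on_compose_gen[OF assms(1) holomorphic_tanhc] assms(2) by (force simp: o_def)

lemma holomorphic_on_artanhc' [holomorphic_intros]:
  assumes "h holomorphic_on S" "\<And>z. z \<in> S \<Longrightarrow> h z \<in> ball 0 1"
  shows "(\<lambda>z. artanhc (h z)) holomorphic_on S"
  using holomorphic_on_compose_gen[OF assms(1) holomorphic_artanhc] assms(2) by (force simp: o_def)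

section \<open>The blown-up equations and their domain\<close>

text \<open>
  \<open>s * inh_ratio \<beta> s t\<close> is \<open>tanh w\<close> and \<open>inv_gain s t\<close> is \<open>\<rho>\<close>, from the difference of the two
  excitatory equations; the factor \<open>s\<close> is cancelled so that \<open>s = 0\<close> is a regular point.
\<close>

definition inh_ratio :: "real \<Rightarrow> 'a \<Rightarrow> 'a \<Rightarrow> 'a::{real_normed_field, banach}"
  where "inh_ratio \<beta> s t = t * (tanhc (s * t) - tanhc s) / (of_real \<beta> * (1 - t))"

definition inv_gain :: "'a \<Rightarrow> 'a \<Rightarrow> 'a::{real_normed_field, banach}"
  where "inv_gain s t = (tanhc s - t * tanhc (s * t)) / (1 - t)"

text \<open>The bracket is the inhibitory equation divided by \<open>\<beta> * s\<close>, left side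
  moved to the right. At \<open>s = 0\<close> it is \<open>\<nu>1 + \<nu>2 * t\<close>, so
  subtracting it divided by \<open>\<nu>2\<close> is a simplified Newton step that is exact
  there.\<close>

definition ratio_map ::
  "real \<Rightarrow> real \<Rightarrow> real \<Rightarrow> real \<Rightarrow> 'a \<Rightarrow> 'a \<Rightarrow> 'a::{real_normed_field, banach, ln}"
  where "ratio_map \<beta> \<nu>1 \<nu>2 c s t =
    t - (of_real \<nu>1 * tanhc s + of_real \<nu>2 * (t * tanhc (s * t)) - of_real c * inh_ratio \<beta> s t
         - inh_ratio \<beta> s t * artanhc (s * inh_ratio \<beta> s t) * inv_gain s t / of_real \<beta>) / of_real \<nu>2"

text \<open>The unit discs contain every argument of \<open>tanhc\<close> and
  \<open>artanhc\<close>, hence no pole or branch cut is met; \<open>t = 1\<close> is the pole of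
  the quotients, where both clusters would coincide.\<close>

definition branch_dom :: "real \<Rightarrow> (complex \<times> complex) set"
  where "branch_dom \<beta> =
    {(s, t). s \<in> ball 0 1 \<and> s * t \<in> ball 0 1 \<and> t \<noteq> 1 \<and> s * inh_ratio \<beta> s t \<in> ball 0 1}"

lemma inh_ratio_0: "inh_ratio \<beta> 0 t = 0" and inv_gain_0: "t \<noteq> 1 \<Longrightarrow> inv_gain 0 t = 1"
  by (simp_all add: inh_ratio_def inv_gain_def)

lemma ratio_map_0: "\<nu>2 \<noteq> 0 \<Longrightarrow> ratio_map \<beta> \<nu>1 \<nu>2 c 0 t = - of_real (\<nu>1 / \<nu>2)"
  by (simp add: ratio_map_def inh_ratio_0 field_simps)

context
  fixes \<beta> :: real and S :: "complex set" and h k :: "complex \<Rightarrow> complex"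
  assumes \<beta>: "\<beta> \<noteq> 0" and h: "h holomorphic_on S" and k: "k holomorphic_on S"
    and dom: "\<And>z. z \<in> S \<Longrightarrow> (h z, k z) \<in> branch_dom \<beta>"
begin

lemma holomorphic_inh_ratio: "(\<lambda>z. inh_ratio \<beta> (h z) (k z)) holomorphic_on S"
  unfolding inh_ratio_def
  by (intro holomorphic_intros h k) (use \<beta> dom in \<open>auto simp: branch_dom_def\<close>)

lemma holomorphic_inv_gain: "(\<lambda>z. inv_gain (h z) (k z)) holomorphic_on S"
  unfolding inv_gain_def
  by (intro holomorphic_intros h k) (use dom in \<open>auto simp: branch_dom_def\<close>)

lemma holomorphic_artanhc_inh: "(\<lambda>z. artanhc (h z * inh_ratio \<beta> (h z) (k z))) holomorphic_on S"
  by (intro holomorphic_intros h holomorphic_inh_ratio) (use dom in \<open>auto simp: branch_dom_def\<close>)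

text \<open>Two curves \<open>h\<close> and \<open>k\<close> in place of \<open>s\<close> and
  \<open>t\<close> cover both uses: \<open>h\<close> constant gives holomorphy in \<open>t\<close>,
  and \<open>h\<close> the identity gives holomorphy after substituting a function of
  \<open>s\<close> for \<open>t\<close>.\<close>

lemma holomorphic_ratio_map:
  assumes "\<nu>2 \<noteq> 0"
  shows "(\<lambda>z. ratio_map \<beta> \<nu>1 \<nu>2 c (h z) (k z)) holomorphic_on S"
  unfolding ratio_map_def
  by (intro holomorphic_intros h k holomorphic_inh_ratio holomorphic_inv_gain holomorphic_artanhc_inh)
    (use \<beta> assms dom in \<open>auto simp: branch_dom_def\<close>)

end

text \<open>Joint openness in \<open>(s, t)\<close>, in the form the tube lemma requires.\<close>

lemma open_branch_dom_preimage:
  assumes "\<beta> \<noteq> 0" "\<nu>2 \<noteq> 0" "open U" "open V"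
  shows "open {(s, t). (s, t) \<in> branch_dom \<beta> \<and> ratio_map \<beta> \<nu>1 \<nu>2 c s t \<in> U \<and> inv_gain s t \<in> V}"
proof -
  \<comment> \<open>Two stages are used: \<open>inh_ratio\<close> is first shown continuous on
    \<open>D1\<close>, and only then is the last condition of \<open>branch_dom\<close> seen to be
    open.\<close>
  define D1 where "D1 = {z :: complex \<times> complex. fst z \<in> ball 0 1 \<and> fst z * snd z \<in> ball 0 1 \<and> snd z \<noteq> 1}"
  have "D1 = {z. norm (fst z) < 1} \<inter> {z. norm (fst z * snd z) < 1} \<inter> {z. snd z \<noteq> 1}"
    by (auto simp: D1_def)
  then have D1: "open D1"
    by (simp only:) (intro open_Int open_Collect_less open_Collect_neq continuous_intros)
  have inh_ratio: "continuous_on D1 (\<lambda>z. inh_ratio \<beta> (fst z) (snd z))"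
    unfolding inh_ratio_def by (intro continuous_intros) (use assms in \<open>auto simp: D1_def\<close>)
  define D where "D = {z \<in> D1. fst z * inh_ratio \<beta> (fst z) (snd z) \<in> ball 0 1}"
  have "open (D1 \<inter> (\<lambda>z. fst z * inh_ratio \<beta> (fst z) (snd z)) -` ball 0 1)"
    by (intro continuous_open_preimage continuous_intros inh_ratio D1 open_ball)
  then have D: "open D"
    by (simp add: D_def vimage_def Int_def)
  have sub: "D \<subseteq> D1" by (auto simp: D_def)
  have gain: "continuous_on D (\<lambda>z. inv_gain (fst z) (snd z))"
    unfolding inv_gain_def by (intro continuous_intros) (auto simp: D_def D1_def)
  have "continuous_on D (\<lambda>z. ratio_map \<beta> \<nu>1 \<nu>2 c (fst z) (snd z))"
    unfolding ratio_map_def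
    by (intro continuous_intros gain continuous_on_subset[OF inh_ratio sub])
      (use assms in \<open>auto simp: D_def D1_def\<close>)
  then have "open (D \<inter> (\<lambda>z. (ratio_map \<beta> \<nu>1 \<nu>2 c (fst z) (snd z), inv_gain (fst z) (snd z))) -` (U \<times> V))"
    by (intro continuous_open_preimage continuous_on_Pair gain D open_Times assms)
  also have "D \<inter> (\<lambda>z. (ratio_map \<beta> \<nu>1 \<nu>2 c (fst z) (snd z), inv_gain (fst z) (snd z))) -` (U \<times> V) =
    {(s, t). (s, t) \<in> branch_dom \<beta> \<and> ratio_map \<beta> \<nu>1 \<nu>2 c s t \<in> U \<and> inv_gain s t \<in> V}"
    by (auto simp: D_def D1_def branch_dom_def)
  finally show ?thesis .
qed

lemma inh_ratio_of_real: "inh_ratio \<beta> (of_real s) (of_real t) = (of_real (inh_ratio \<beta> s t) :: complex)"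
  by (simp add: inh_ratio_def flip: tanhc_of_real)

lemma inv_gain_of_real: "inv_gain (of_real s) (of_real t) = (of_real (inv_gain s t) :: complex)"
  by (simp add: inv_gain_def tanhc_of_real flip: of_real_mult)

lemma ratio_map_of_real:
  assumes "\<bar>s * inh_ratio \<beta> s t\<bar> < 1"
  shows "ratio_map \<beta> \<nu>1 \<nu>2 c (of_real s) (of_real t) = (of_real (ratio_map \<beta> \<nu>1 \<nu>2 c s t) :: complex)"
  using artanhc_of_real[OF assms]
  by (simp add: ratio_map_def tanhc_of_real inh_ratio_of_real inv_gain_of_real flip: of_real_mult)

lemma branch_dom_of_real:
  "(of_real s, of_real t) \<in> branch_dom \<beta> \<longleftrightarrow>
    \<bar>s\<bar> < 1 \<and> \<bar>s * t\<bar> < 1 \<and> t \<noteq> 1 \<and> \<bar>s * inh_ratio \<beta> s t\<bar> < 1"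
  by (simp add: branch_dom_def inh_ratio_of_real flip: of_real_mult)

section \<open>The cluster ratio as a holomorphic function of the amplitude\<close>

text \<open>At \<open>s = 0\<close> the map is constant and all conditions hold on a whole closed
  disc of ratios; by compactness they persist on that disc for small \<open>s\<close>, where the
  fixed-point lemma applies.\<close>

lemma branch_ratio_exists:
  assumes "\<beta> \<noteq> 0" "\<nu>1 > 0" "\<nu>2 > 0"
  obtains \<delta> \<tau> where "\<delta> > 0" "\<tau> holomorphic_on ball 0 \<delta>"
    "\<And>s. s \<in> ball 0 \<delta> \<Longrightarrow> (s, \<tau> s) \<in> branch_dom \<beta>"
    "\<And>s. s \<in> ball 0 \<delta> \<Longrightarrow> inv_gain s (\<tau> s) \<noteq> 0"
    "\<And>s. s \<in> ball 0 \<delta> \<Longrightarrow> ratio_map \<beta> \<nu>1 \<nu>2 c s (\<tau> s) = \<tau> s"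
    "\<And>s. s \<in> ball 0 \<delta> \<Longrightarrow> s \<in> \<real> \<Longrightarrow> \<tau> s \<in> \<real>"
proof -
  let ?P = "ratio_map \<beta> \<nu>1 \<nu>2 c :: complex \<Rightarrow> complex \<Rightarrow> complex"
  define t0 :: complex where "t0 = - of_real (\<nu>1 / \<nu>2)"
  \<comment> \<open>The radius \<open>1 / 8\<close> is the one demanded by
    \<open>holomorphic_fixed_point\<close> with \<open>r = 1\<close>; the condition on
    \<open>inv_gain\<close> later permits division by it to recover the gain.\<close>
  define W where "W = {(s, t). (s, t) \<in> branch_dom \<beta> \<and> ?P s t \<in> ball t0 (1 / 8) \<and> inv_gain s t \<in> - {0}}"
  have W: "open W"
    unfolding W_def by (rule open_branch_dom_preimage) (use assms in auto)
  have "\<nu>1 / \<nu>2 > 0" using assms by simp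
  \<comment> \<open>Since \<open>t0\<close> is real and negative, its distance to 1 exceeds
    1.\<close>
  have ne1: "t \<noteq> 1" if "t \<in> cball t0 1" for t
  proof
    assume "t = 1"
    then have "norm (of_real (1 + \<nu>1 / \<nu>2) :: complex) \<le> 1" 
      using that by (simp add: t0_def dist_norm norm_minus_commute)
    then show False using \<open>\<nu>1 / \<nu>2 > 0\<close> unfolding norm_of_real by simp
  qed
  have "(0, t) \<in> W" if "t \<in> cball t0 1" for t
    using ne1[OF that] assms
    by (simp add: W_def branch_dom_def inv_gain_0 ratio_map_0 t0_def del: of_real_divide)
  then have "{0} \<times> cball t0 1 \<subseteq> W" by auto
  from Elementary_Topology.tube_lemma[OF compact_cball W this]
  obtain X0 where "0 \<in> X0" "open X0" and X0: "X0 \<times> cball t0 1 \<subseteq> W" by blast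
  then obtain \<delta> where "\<delta> > 0" and \<delta>: "ball 0 \<delta> \<subseteq> X0"
    by (meson open_contains_ball)
  have W_ball: "(s, t) \<in> W" if "s \<in> ball 0 \<delta>" "t \<in> ball t0 1" for s t
    using that \<delta> X0 ball_subset_cball by blast
  have "\<beta> \<noteq> 0" "\<nu>2 \<noteq> 0" using assms by auto
  obtain \<tau> where \<tau>: "\<tau> holomorphic_on ball 0 \<delta>" "\<tau> ` ball 0 \<delta> \<subseteq> ball t0 1"
    "\<And>s. s \<in> ball 0 \<delta> \<Longrightarrow> ?P s (\<tau> s) = \<tau> s"
    "\<And>s. s \<in> ball 0 \<delta> \<Longrightarrow> t0 \<in> \<real> \<Longrightarrow> (\<And>t. t \<in> \<real> \<inter> ball t0 1 \<Longrightarrow> ?P s t \<in> \<real>) \<Longrightarrow> \<tau> s \<in> \<real>"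
  proof (rule holomorphic_fixed_point[of 1 "ball 0 \<delta>" t0 ?P])
    show "?P s t \<in> ball t0 (1 / 8)" if "s \<in> ball 0 \<delta>" "t \<in> ball t0 1" for s t
      using W_ball[OF that] by (simp add: W_def)
    show "?P s holomorphic_on ball t0 1" if "s \<in> ball 0 \<delta>" for s
      using holomorphic_ratio_map[of \<beta> "\<lambda>_. s" "ball t0 1" "\<lambda>t. t" \<nu>2 \<nu>1 c] W_ball[OF that]
        \<open>\<beta> \<noteq> 0\<close> \<open>\<nu>2 \<noteq> 0\<close> by (simp add: W_def)
    show "(\<lambda>s. ?P s (\<phi> s)) holomorphic_on ball 0 \<delta>"
      if "\<phi> holomorphic_on ball 0 \<delta>" "\<phi> ` ball 0 \<delta> \<subseteq> ball t0 1" for \<phi>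
      using holomorphic_ratio_map[of \<beta> "\<lambda>s. s" "ball 0 \<delta>" \<phi> \<nu>2 \<nu>1 c] W_ball that
        \<open>\<beta> \<noteq> 0\<close> \<open>\<nu>2 \<noteq> 0\<close> by (simp add: W_def image_subset_iff)
  qed (use that in auto)
  have \<tau>_W: "(s, \<tau> s) \<in> W" if "s \<in> ball 0 \<delta>" for s
    using \<tau>(2) that by (blast intro: W_ball)
  show ?thesis
  proof
    fix s :: complex assume s: "s \<in> ball 0 \<delta>" and "s \<in> \<real>"
    then obtain s' where s': "s = of_real s'" by (auto elim: Reals_cases)
    show "\<tau> s \<in> \<real>"
    proof (rule \<tau>(4)[OF s])
      show "t0 \<in> \<real>" by (simp add: t0_def)
      fix t assume t: "t \<in> \<real> \<inter> ball t0 1"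
      then obtain t' where t': "t = of_real t'" by (auto elim: Reals_cases)
      \<comment> \<open>Membership bounds the argument of \<open>artanhc\<close> by 1 in modulus, so
        that the real and the complex \<open>ratio_map\<close> agree.\<close>
      have "(s, t) \<in> branch_dom \<beta>" using W_ball[OF s, of t] t by (simp add: W_def)
      then show "?P s t \<in> \<real>"
        by (simp add: s' t' branch_dom_of_real ratio_map_of_real)
    qed
  qed (use \<open>\<delta> > 0\<close> \<tau> \<tau>_W in \<open>auto simp: W_def\<close>)
qed

section \<open>Smooth real curves from holomorphic functions\<close>

text \<open>Complex derivatives restrict to the real axis, and \<open>Re\<close> is bounded linear;
  the real parts of the iterated derivatives thus witness smoothness.\<close>

lemma has_vector_derivative_Re_higher_deriv:
  assumes "h holomorphic_on ball 0 \<delta>" and "s \<in> {-\<delta><..<\<delta>}"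
  shows "((\<lambda>s. Re ((deriv ^^ n) h (of_real s))) has_vector_derivative
           Re ((deriv ^^ Suc n) h (of_real s))) (at s)"
proof -
  have "complex_of_real s \<in> ball 0 \<delta>" using assms(2) by auto
  then have "((deriv ^^ n) h has_field_derivative (deriv ^^ Suc n) h (of_real s)) (at (of_real s))"
    using holomorphic_derivI[OF holomorphic_higher_deriv[OF assms(1) open_ball] open_ball] by simp
  from has_vector_derivative_real_field[OF this] show ?thesis
    by (rule bounded_linear.has_vector_derivative[OF bounded_linear_Re])
qed

lemma smooth_curve_on_Re_holomorphic:
  assumes "h holomorphic_on ball 0 \<delta>"
  shows "smooth_curve_on {-\<delta><..<\<delta>} (\<lambda>s. Re (h (of_real s)))"
  unfolding smooth_curve_on_def
  by (rule exI[of _ "\<lambda>n s. Re ((deriv ^^ n) h (of_real s))"])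
    (use has_vector_derivative_Re_higher_deriv[OF assms] in auto)

lemma smooth_curve_on_vec:
  fixes x :: "real \<Rightarrow> real ^ 'n"
  assumes "\<And>a. smooth_curve_on S (\<lambda>s. x s $ a)"
  shows "smooth_curve_on S x"
proof -
  from assms obtain D where D: "\<And>a. D a 0 = (\<lambda>s. x s $ a)"
    "\<And>a n s. s \<in> S \<Longrightarrow> (D a n has_vector_derivative D a (Suc n) s) (at s)"
    unfolding smooth_curve_on_def by metis
  have "((\<lambda>s. \<chi> a. D a n s) has_vector_derivative (\<chi> a. D a (Suc n) s)) (at s)" if "s \<in> S" for n s
    unfolding has_vector_derivative_def
    by (subst has_derivative_componentwise_within)
      (use D(2)[OF that] in \<open>auto simp: Basis_vec_def inner_axis has_vector_derivative_def\<close>)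
  then show ?thesis
    unfolding smooth_curve_on_def
    by (intro exI[of _ "\<lambda>n s. \<chi> a. D a n s"]) (auto simp: D(1))
qed


section \<open>Return to the equilibrium equations and their symmetry\<close>

text \<open>Undoes the blow-up. The excitatory equations hold by the choice of
  \<open>inh_ratio\<close> and \<open>inv_gain\<close>, after cancelling \<open>1 - t\<close>; the
  inhibitory one is the fixed-point equation. Each is then multiplied by \<open>s\<close>, so
  \<open>s = 0\<close> is covered too.\<close>

lemma ratio_map_fixed_point_equations:
  fixes s t w :: real
  assumes "\<beta> \<noteq> 0" "\<nu>2 \<noteq> 0" "t \<noteq> 1" "\<bar>s * inh_ratio \<beta> s t\<bar> < 1"
    and fixed: "ratio_map \<beta> \<nu>1 \<nu>2 c s t = t"
  defines "w \<equiv> artanh (s * inh_ratio \<beta> s t)"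
  shows "s * inv_gain s t = tanh s - \<beta> * tanh w"
    and "s * t * inv_gain s t = tanh (s * t) - \<beta> * tanh w"
    and "w * inv_gain s t = \<beta> * (\<nu>1 * tanh s + \<nu>2 * tanh (s * t)) - \<beta> * c * tanh w"
proof -
  define y where "y = inh_ratio \<beta> s t"
  have y: "\<beta> * y * (1 - t) = t * (tanhc (s * t) - tanhc s)"
    using assms by (simp add: y_def inh_ratio_def)
  have \<rho>: "inv_gain s t * (1 - t) = tanhc s - t * tanhc (s * t)"
    using assms by (simp add: inv_gain_def)
  have tw: "tanh w = s * y" using assms by (simp add: w_def y_def tanh_artanh_real)
  have ts: "tanh s = s * tanhc s" "tanh (s * t) = s * (t * tanhc (s * t))"
    by (simp_all add: mult_tanhc flip: mult.assoc)
  have "(inv_gain s t - (tanhc s - \<beta> * y)) * (1 - t) = 0"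
    using y \<rho> by (simp add: algebra_simps)
  then have 1: "inv_gain s t = tanhc s - \<beta> * y" using assms(3) by simp
  have "(t * inv_gain s t - (t * tanhc (s * t) - \<beta> * y)) * (1 - t) = 0"
    using y arg_cong[OF \<rho>, of "\<lambda>z. t * z"] by (simp add: algebra_simps)
  then have 2: "t * inv_gain s t = t * tanhc (s * t) - \<beta> * y" using assms(3) by simp
  have 3: "y * artanhc (s * y) * inv_gain s t = \<beta> * (\<nu>1 * tanhc s + \<nu>2 * (t * tanhc (s * t))) - \<beta> * c * y"
    using fixed assms(1,2) unfolding ratio_map_def y_def[symmetric] by (simp add: field_simps)
  show "s * inv_gain s t = tanh s - \<beta> * tanh w"
    using arg_cong[OF 1, of "\<lambda>z. s * z"] by (simp add: tw ts algebra_simps)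
  show "s * t * inv_gain s t = tanh (s * t) - \<beta> * tanh w"
    using arg_cong[OF 2, of "\<lambda>z. s * z"] by (simp add: tw ts algebra_simps)
  have "w * inv_gain s t = s * (y * artanhc (s * y) * inv_gain s t)"
    by (simp add: w_def y_def flip: mult_artanhc)
  then show "w * inv_gain s t = \<beta> * (\<nu>1 * tanh s + \<nu>2 * tanh (s * t)) - \<beta> * c * tanh w"
    unfolding 3 by (simp add: tw ts algebra_simps)
qed

lemma sum_UNIV_Plus:
  fixes F :: "'a::finite + 'b::finite \<Rightarrow> 'd::comm_monoid_add"
  shows "(\<Sum>k\<in>UNIV. F k) = (\<Sum>i\<in>UNIV. F (Inl i)) + (\<Sum>j\<in>UNIV. F (Inr j))"
  by (subst UNIV_Plus_UNIV[symmetric], subst sum.Plus) simp_all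

text \<open>The excitatory block of \<open>H_tilde\<close> is diagonal: clusters interact only
  through the inhibitory cells.\<close>

lemma F_tilde_Inl:
  fixes x :: "real ^ ('c::finite + 'i::finite)"
  assumes "\<And>j. x $ Inr j = c"
  shows "F_tilde p \<alpha> \<mu> N x g $ Inl i = - (x $ Inl i) + 1 / sqrt (real N) *
    ((real p - 1) * real CARD('c) * \<mu> * tanh (g * x $ Inl i) - \<alpha> * \<mu> * real CARD('i) * tanh (g * c))"
  by (simp add: F_tilde_def matrix_vector_mult_def sum_UNIV_Plus H_tilde_def block_mat_def
      ones_mat_def tanh_vec_def mat_def assms if_distrib if_distribR cong: if_cong)

lemma F_tilde_Inr:
  fixes x :: "real ^ ('c::finite + 'i::finite)"
  assumes "C1 \<union> C2 = UNIV" "C1 \<inter> C2 = {}"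
    and "\<And>i. i \<in> C1 \<Longrightarrow> x $ Inl i = a" "\<And>i. i \<in> C2 \<Longrightarrow> x $ Inl i = b" "\<And>j. x $ Inr j = c"
  shows "F_tilde p \<alpha> \<mu> N x g $ Inr j = - c + 1 / sqrt (real N) *
    (real p * \<mu> * (real (card C1) * tanh (g * a) + real (card C2) * tanh (g * b))
      - \<alpha> * \<mu> * (real CARD('i) - 1) * tanh (g * c))"
proof -
  have "(\<Sum>i\<in>UNIV. tanh (g * x $ Inl i)) = (\<Sum>i\<in>C1. tanh (g * x $ Inl i)) + (\<Sum>i\<in>C2. tanh (g * x $ Inl i))"
    using assms(1,2) by (subst assms(1)[symmetric]) (intro sum.union_disjoint, auto)
  also have "\<dots> = real (card C1) * tanh (g * a) + real (card C2) * tanh (g * b)"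
    by (simp add: assms)
  finally have E: "(\<Sum>i\<in>UNIV. tanh (g * x $ Inl i)) = \<dots>" .
  \<comment> \<open>The zero diagonal of \<open>K_mat\<close> removes self-inhibition and leaves
    \<open>CARD('i) - 1\<close> equal terms.\<close>
  have I: "(\<Sum>k\<in>UNIV. (1 - (if j = k then 1 else 0)) * tanh (g * c)) = (real CARD('i) - 1) * tanh (g * c)"
    by (simp add: sum_subtractf flip: sum_distrib_right)
  have "F_tilde p \<alpha> \<mu> N x g $ Inr j = - c + 1 / sqrt (real N) *
    (real p * \<mu> * (\<Sum>i\<in>UNIV. tanh (g * x $ Inl i))
      - \<alpha> * \<mu> * (\<Sum>k\<in>UNIV. (1 - (if j = k then 1 else 0)) * tanh (g * c)))"
    by (simp add: F_tilde_def matrix_vector_mult_def sum_UNIV_Plus H_tilde_def block_mat_def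
        ones_mat_def K_mat_def tanh_vec_def mat_def assms(5) sum_distrib_left sum_negf mult.assoc)
  then show ?thesis unfolding E I by (simp add: mult.assoc)
qed

text \<open>Because \<open>a \<noteq> b\<close>, the coordinates detect membership in
  \<open>C1\<close>, so a permutation fixes \<open>x\<close> only if it preserves \<open>C1\<close>,
  and by bijectivity then also its complement \<open>C2\<close>. Inhibitory permutations act
  trivially.\<close>

lemma isotropy_subgroup_two_clusters:
  fixes x :: "real ^ ('c::finite + 'i::finite)"
  assumes part: "C1 \<union> C2 = UNIV" "C1 \<inter> C2 = {}"
    and a: "\<And>i. i \<in> C1 \<Longrightarrow> x $ Inl i = a" and b: "\<And>i. i \<in> C2 \<Longrightarrow> x $ Inl i = b"
    and c: "\<And>j. x $ Inr j = c" and "a \<noteq> b"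
  shows "isotropy_subgroup x = Sigma_C C1 C2"
proof -
  have mem: "x $ Inl i = x $ Inl i' \<longleftrightarrow> (i \<in> C1 \<longleftrightarrow> i' \<in> C1)" for i i'
    using part a b \<open>a \<noteq> b\<close> by (metis UNIV_I Un_iff disjoint_iff)
  have C2: "C2 = - C1" using part by blast
  have "Gamma_act \<gamma> x = x \<longleftrightarrow> fst \<gamma> ` C1 = C1 \<and> fst \<gamma> ` C2 = C2" if "\<gamma> \<in> Gamma" for \<gamma>
  proof -
    have bij: "bij (fst \<gamma>)" using that by (auto simp: Gamma_def permutes_imp_bij permutes_bij)
    have "Gamma_act \<gamma> x = x \<longleftrightarrow> (\<forall>i. x $ Inl (inv (fst \<gamma>) i) = x $ Inl i)"
      by (auto simp: Gamma_act_def vec_eq_iff c split: sum.splits)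
    also have "\<dots> \<longleftrightarrow> (\<forall>i. inv (fst \<gamma>) i \<in> C1 \<longleftrightarrow> i \<in> C1)"
      by (simp add: mem)
    also have "\<dots> \<longleftrightarrow> fst \<gamma> ` C1 = C1"
      using bij_image_Collect_eq[OF bij, of "\<lambda>i. i \<in> C1"] by auto
    also have "\<dots> \<longleftrightarrow> fst \<gamma> ` C1 = C1 \<and> fst \<gamma> ` C2 = C2"
      using bij by (auto simp: C2 bij_image_Compl_eq)
    finally show ?thesis .
  qed
  then show ?thesis unfolding isotropy_subgroup_def Sigma_C_def by blast
qed

section \<open>Assembly of the bifurcating branch\<close>

theorem mainTheorem7:
  fixes n_C n_I p n_E N n_C1 n_C2 :: nat
    and f \<alpha> \<mu> g_C :: real
    and C1 C2 :: "'c::finite set"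
  assumes "CARD('c) = n_C" and "CARD('i::finite) = n_I"
    and "n_C \<ge> 2" and "n_I \<ge> 1" and "p > 1"
    and "n_E = p * n_C" and "N = n_E + n_I"
    and "f = real n_E / real N" and "\<alpha> = f / (1 - f)"
    and "real n_C \<ge> \<alpha>" and "\<mu> > 0"
    and "g_C = sqrt (real N) / ((real p - 1) * real n_C * \<mu>)"
    and "n_C1 \<ge> 1" and "n_C2 \<ge> 1" and "n_C1 + n_C2 = n_C"
    and "C1 \<union> C2 = UNIV" and "C1 \<inter> C2 = {}"
    and "card C1 = n_C1" and "card C2 = n_C2"
  shows "\<exists>(x :: real \<Rightarrow> real ^ ('c + 'i)) (g :: real \<Rightarrow> real) (\<delta> :: real).
    \<delta> > 0 \<and>
    smooth_curve_on {-\<delta><..<\<delta>} x \<and> smooth_curve_on {-\<delta><..<\<delta>} g \<and>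
    x 0 = 0 \<and> g 0 = g_C \<and> vector_derivative x (at 0) \<noteq> 0 \<and>
    (\<forall>s\<in>{-\<delta><..<\<delta>}. F_tilde p \<alpha> \<mu> N (x s) (g s) = 0) \<and>
    (\<forall>s\<in>{-\<delta><..<\<delta>}. s \<noteq> 0 \<longrightarrow>
       isotropy_subgroup (x s) = Sigma_C C1 C2 \<and>
       (\<exists>x_E1 x_E2 x_I. x_E2 \<noteq> x_E1 \<and>
          (\<forall>i\<in>C1. x s $ Inl i = x_E1) \<and>
          (\<forall>i\<in>C2. x s $ Inl i = x_E2) \<and>
          (\<forall>j. x s $ Inr j = x_I)))"
proof -
  note part = \<open>C1 \<union> C2 = UNIV\<close> \<open>C1 \<inter> C2 = {}\<close>
  define \<beta> where "\<beta> = real p / (real p - 1)"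
  define \<nu>1 where "\<nu>1 = real n_C1 / real n_C"
  define \<nu>2 where "\<nu>2 = real n_C2 / real n_C"
  define c where "c = 1 - 1 / real n_I"
  have pos: "real p > 1" "real n_C > 0" "real n_I > 0" "real n_C1 > 0" "real n_C2 > 0"
    using assms(3-5,13,14) by linarith+
  have "N > 0" using assms(4,7) by linarith
  have "g_C > 0" unfolding assms(12) using pos \<open>N > 0\<close> \<open>\<mu> > 0\<close> by simp
  have "real N \<noteq> 0" "real N = real n_E + real n_I"
    using \<open>N > 0\<close> by (simp, simp add: assms(7))
  then have "1 - f = real n_I / real N"
    unfolding assms(8) by (metis add_diff_cancel_left' diff_divide_distrib divide_self)
  then have \<alpha>: "\<alpha> * real n_I = real p * real n_C"
    unfolding assms(9,8) using pos \<open>N > 0\<close> assms(6) by simp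
  have "\<beta> \<noteq> 0" "\<nu>1 > 0" "\<nu>2 > 0" using pos by (auto simp: \<beta>_def \<nu>1_def \<nu>2_def)
  then obtain \<delta> \<tau> where "\<delta> > 0" and \<tau>: "\<tau> holomorphic_on ball 0 \<delta>"
    "\<And>s. s \<in> ball 0 \<delta> \<Longrightarrow> (s, \<tau> s) \<in> branch_dom \<beta>"
    "\<And>s. s \<in> ball 0 \<delta> \<Longrightarrow> inv_gain s (\<tau> s) \<noteq> 0"
    "\<And>s. s \<in> ball 0 \<delta> \<Longrightarrow> ratio_map \<beta> \<nu>1 \<nu>2 c s (\<tau> s) = \<tau> s"
    "\<And>s. s \<in> ball 0 \<delta> \<Longrightarrow> s \<in> \<real> \<Longrightarrow> \<tau> s \<in> \<real>"
    by (rule branch_ratio_exists[where c = c]) blast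
  define \<rho> where "\<rho> s = inv_gain s (\<tau> s)" for s
  define y where "y s = inh_ratio \<beta> s (\<tau> s)" for s
  have hol: "\<rho> holomorphic_on ball 0 \<delta>" "y holomorphic_on ball 0 \<delta>"
    "(\<lambda>s. artanhc (s * y s)) holomorphic_on ball 0 \<delta>"
    unfolding \<rho>_def[abs_def] y_def[abs_def]
    using holomorphic_inv_gain[OF \<open>\<beta> \<noteq> 0\<close> holomorphic_on_ident \<tau>(1,2)]
      holomorphic_inh_ratio[OF \<open>\<beta> \<noteq> 0\<close> holomorphic_on_ident \<tau>(1,2)]
      holomorphic_artanhc_inh[OF \<open>\<beta> \<noteq> 0\<close> holomorphic_on_ident \<tau>(1,2)]
    by simp_all
  \<comment> \<open>\<open>q\<close> is \<open>1 / g\<close>, which turns the scaled unknowns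
    \<open>u\<close>, \<open>v\<close>, \<open>w\<close> back into activities.\<close>
  define q where "q = (\<lambda>s. \<rho> s / of_real g_C)"
  have hol_q: "q holomorphic_on ball 0 \<delta>"
    unfolding q_def by (intro holomorphic_intros hol) (use \<open>g_C > 0\<close> in auto)
  have q_0: "q 0 = of_real (1 / g_C)"
    using \<tau>(2)[of 0] \<open>\<delta> > 0\<close> by (simp add: q_def \<rho>_def inv_gain_0 branch_dom_def)
  define h :: "'c + 'i \<Rightarrow> complex \<Rightarrow> complex" where "h k = (case k of
      Inl i \<Rightarrow> if i \<in> C1 then (\<lambda>s. s * q s) else (\<lambda>s. s * \<tau> s * q s)
    | Inr j \<Rightarrow> (\<lambda>s. s * y s * artanhc (s * y s) * q s))" for k
  \<comment> \<open>For real \<open>s\<close> the ratio \<open>\<tau>\<close> is real, hence so are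
    all components, and taking real parts changes no value.\<close>
  define x where "x s = (\<chi> k. Re (h k (of_real s)))" for s :: real
  define g where "g s = Re (of_real g_C / \<rho> (of_real s))" for s :: real
  define t where "t s = Re (\<tau> (of_real s))" for s :: real
  have dom: "\<bar>s * t s\<bar> < 1" "t s \<noteq> 1" "\<bar>s * inh_ratio \<beta> s (t s)\<bar> < 1"
    and gain: "inv_gain s (t s) \<noteq> 0" and fixed: "ratio_map \<beta> \<nu>1 \<nu>2 c s (t s) = t s"
    and g: "g s = g_C / inv_gain s (t s)"
    and x1: "i \<in> C1 \<Longrightarrow> x s $ Inl i = s / g s"
    and x2: "i \<in> C2 \<Longrightarrow> x s $ Inl i = s * t s / g s"
    and x3: "x s $ Inr j = artanh (s * inh_ratio \<beta> s (t s)) / g s" if "s \<in> {-\<delta><..<\<delta>}" for s i j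
  proof -
    have s: "complex_of_real s \<in> ball 0 \<delta>" using that by auto
    have \<tau>s: "\<tau> (of_real s) = of_real (t s)"
      using \<tau>(5)[OF s] by (simp add: t_def)
    show d: "\<bar>s * t s\<bar> < 1" "t s \<noteq> 1" "\<bar>s * inh_ratio \<beta> s (t s)\<bar> < 1"
      using \<tau>(2)[OF s] by (simp_all add: \<tau>s branch_dom_of_real)
    show "inv_gain s (t s) \<noteq> 0" using \<tau>(3)[OF s] by (simp add: \<tau>s inv_gain_of_real)
    show "ratio_map \<beta> \<nu>1 \<nu>2 c s (t s) = t s"
      using \<tau>(4)[OF s] by (simp add: \<tau>s ratio_map_of_real[OF d(3)])
    have r: "\<rho> (of_real s) = of_real (inv_gain s (t s))" "y (of_real s) = of_real (inh_ratio \<beta> s (t s))"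
      by (simp_all add: \<rho>_def y_def \<tau>s inv_gain_of_real inh_ratio_of_real)
    then show gs: "g s = g_C / inv_gain s (t s)" by (simp add: g_def flip: of_real_divide)
    have qs: "q (of_real s) = of_real (inverse (g s))"
      by (simp add: q_def r gs)
    show "i \<in> C1 \<Longrightarrow> x s $ Inl i = s / g s" "i \<in> C2 \<Longrightarrow> x s $ Inl i = s * t s / g s"
      using part by (auto simp: x_def h_def qs \<tau>s divide_inverse simp flip: of_real_mult of_real_inverse)
    have "artanhc (of_real (s * inh_ratio \<beta> s (t s)) :: complex) = of_real (artanhc (s * inh_ratio \<beta> s (t s)))"
      using d(3) by (rule artanhc_of_real)
    then show "x s $ Inr j = artanh (s * inh_ratio \<beta> s (t s)) / g s"
      by (simp add: x_def h_def qs r divide_inverse flip: of_real_mult of_real_inverse mult_artanhc)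
  qed
  have in0: "0 \<in> {-\<delta><..<\<delta>}" using \<open>\<delta> > 0\<close> by simp
  have "h k holomorphic_on ball 0 \<delta>" for k
    by (auto simp: h_def split: sum.splits intro!: holomorphic_intros hol hol_q \<tau>(1))
  then have smooth_x: "smooth_curve_on {-\<delta><..<\<delta>} x"
    by (intro smooth_curve_on_vec) (simp add: x_def smooth_curve_on_Re_holomorphic)
  have smooth_g: "smooth_curve_on {-\<delta><..<\<delta>} g"
    unfolding g_def[abs_def]
    by (intro smooth_curve_on_Re_holomorphic holomorphic_intros hol) (use \<tau>(3) in \<open>auto simp: \<rho>_def\<close>)
  have x_0: "x 0 = 0"
  proof -
    have "x 0 $ Inl i = 0" for i
      using x1[OF in0, of i] x2[OF in0, of i] part by (cases "i \<in> C1") auto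
    moreover have "x 0 $ Inr j = 0" for j
      using x3[OF in0] by simp
    ultimately show ?thesis by (simp add: vec_eq_iff split_sum_all)
  qed
  have g_0: "g 0 = g_C"
    using g[OF in0] dom(2)[OF in0] by (simp add: inv_gain_0)
  have deriv: "vector_derivative x (at 0) \<noteq> 0"
  proof
    assume 0: "vector_derivative x (at 0) = 0"
    from smooth_x in0 obtain x' where "(x has_vector_derivative x') (at 0)"
      unfolding smooth_curve_on_def by metis
    with 0 have "(x has_vector_derivative 0) (at 0)"
      by (simp add: vector_derivative_at)
    \<comment> \<open>A coordinate in the first group is \<open>s * q s\<close>, with velocity
      \<open>q 0 = 1 / g_C \<noteq> 0\<close>.\<close>
    obtain i where i: "i \<in> C1" using assms(13,18) by (metis card.empty all_not_in_conv not_one_le_zero)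
    have "((\<lambda>s. x s $ Inl i) has_vector_derivative (0 :: real ^ ('c + 'i)) $ Inl i) (at 0)"
      by (rule bounded_linear.has_vector_derivative[OF bounded_linear_vec_nth]) fact
    moreover have "((\<lambda>s. x s $ Inl i) has_vector_derivative 1 / g_C) (at 0)"
    proof -
      have "(q has_field_derivative deriv q 0) (at 0)"
        using holomorphic_derivI[OF hol_q open_ball, of 0] \<open>\<delta> > 0\<close> by simp
      from DERIV_mult[OF DERIV_ident this]
      have "((\<lambda>s. s * q s) has_field_derivative of_real (1 / g_C)) (at (of_real 0))"
        by (simp add: q_0)
      from bounded_linear.has_vector_derivative[OF bounded_linear_Re has_vector_derivative_real_field[OF this]]
      show ?thesis using i by (simp add: x_def h_def)
    qed
    ultimately have "(0 :: real ^ ('c + 'i)) $ Inl i = 1 / g_C" by (rule vector_derivative_unique_at)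
    with \<open>g_C > 0\<close> show False by simp
  qed
  have equil: "F_tilde p \<alpha> \<mu> N (x s) (g s) = 0" if s: "s \<in> {-\<delta><..<\<delta>}" for s
  proof -
    define w where "w = artanh (s * inh_ratio \<beta> s (t s))"
    define r where "r = inv_gain s (t s)"
    have "\<nu>2 \<noteq> 0" using \<open>\<nu>2 > 0\<close> by simp
    note eqs = ratio_map_fixed_point_equations[OF \<open>\<beta> \<noteq> 0\<close> this dom(2,3)[OF s] fixed[OF s],
        folded w_def r_def]
    have g_cancel: "g s * (a / g s) = a" for a using g[OF s] gain[OF s] \<open>g_C > 0\<close> by simp
    have gi: "a / g s = 1 / g_C * (a * r)" for a
      using g[OF s] by (simp add: r_def)
    \<comment> \<open>The choice of \<open>g_C\<close> makes the excitatory self-coupling over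
      \<open>sqrt (real N)\<close> equal to \<open>1 / g_C\<close>. With \<alpha> n_I = p n_C, every
      equation then becomes \<open>1 / g_C\<close> times its scaled form.\<close>
    have sqN: "sqrt (real N) = g_C * ((real p - 1) * real n_C * \<mu>)"
      using pos \<open>\<mu> > 0\<close> assms(12) by simp
    have scale: "1 / sqrt (real N) * (((real p - 1) * real n_C * \<mu>) * A) = 1 / g_C * A" for A
      unfolding sqN using pos \<open>\<mu> > 0\<close> by simp
    have E: "1 / sqrt (real N) * ((real p - 1) * real n_C * \<mu> * U - \<alpha> * \<mu> * real n_I * W)
        = 1 / g_C * (U - \<beta> * W)" for U W
    proof -
      have 1: "\<alpha> * \<mu> * real n_I = (real p - 1) * real n_C * \<mu> * \<beta>"
        using \<alpha> pos by (simp add: \<beta>_def)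
      show ?thesis
        unfolding 1 scale[symmetric] by (simp only: right_diff_distrib mult.assoc)
    qed
    have I: "1 / sqrt (real N) * (real p * \<mu> * (real n_C1 * U + real n_C2 * V) - \<alpha> * \<mu> * (real n_I - 1) * W)
        = 1 / g_C * (\<beta> * (\<nu>1 * U + \<nu>2 * V) - \<beta> * c * W)" for U V W
    proof -
      have 1: "\<alpha> * \<mu> * (real n_I - 1) = (real p - 1) * real n_C * \<mu> * (\<beta> * c)"
      proof -
        have "\<alpha> * \<mu> * (real n_I - 1) = \<alpha> * real n_I * \<mu> * c"
          using pos by (simp add: c_def right_diff_distrib)
        then show ?thesis unfolding \<alpha> using pos by (simp add: \<beta>_def mult.left_commute)
      qed
      have 2: "real p * \<mu> * (real n_C1 * U + real n_C2 * V)
          = (real p - 1) * real n_C * \<mu> * (\<beta> * (\<nu>1 * U + \<nu>2 * V))"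
        using pos by (simp add: \<beta>_def \<nu>1_def \<nu>2_def field_simps)
      show ?thesis
        unfolding 1 2 scale[symmetric] by (simp only: right_diff_distrib mult.assoc)
    qed
    note x_eqs = x1[OF s] x2[OF s] x3[OF s, folded w_def]
    have "F_tilde p \<alpha> \<mu> N (x s) (g s) $ Inl i = 0" for i
    proof (cases "i \<in> C1")
      case True
      show ?thesis
        unfolding F_tilde_Inl[of "x s", OF x_eqs(3)] assms(1,2) E x_eqs(1)[OF True]
        unfolding g_cancel unfolding gi eqs(1) by simp
    next
      case False
      then have "i \<in> C2" using part by blast
      show ?thesis
        unfolding F_tilde_Inl[of "x s", OF x_eqs(3)] assms(1,2) E x2[OF s \<open>i \<in> C2\<close>]
        unfolding g_cancel unfolding gi eqs(2) by simp
    qed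
    moreover have "F_tilde p \<alpha> \<mu> N (x s) (g s) $ Inr j = 0" for j
    proof -
      have "F_tilde p \<alpha> \<mu> N (x s) (g s) $ Inr j =
          - (w / g s) + 1 / g_C * (\<beta> * (\<nu>1 * tanh s + \<nu>2 * tanh (s * t s)) - \<beta> * c * tanh w)"
        using F_tilde_Inr[OF part, of "x s" "s / g s" "s * t s / g s" "w / g s"] x_eqs
        by (simp only: assms(1,2,18,19) I g_cancel)
      then show ?thesis unfolding gi eqs(3) by simp
    qed
    ultimately show ?thesis by (simp add: vec_eq_iff split_sum_all)
  qed
  have sym: "isotropy_subgroup (x s) = Sigma_C C1 C2 \<and>
       (\<exists>x_E1 x_E2 x_I. x_E2 \<noteq> x_E1 \<and>
          (\<forall>i\<in>C1. x s $ Inl i = x_E1) \<and>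
          (\<forall>i\<in>C2. x s $ Inl i = x_E2) \<and>
          (\<forall>j. x s $ Inr j = x_I))"
    if s: "s \<in> {-\<delta><..<\<delta>}" and "s \<noteq> 0" for s
  proof -
    have "g s \<noteq> 0" using g[OF s] gain[OF s] \<open>g_C > 0\<close> by simp
    \<comment> \<open>The two cluster values differ by the factor \<open>t s\<close>, which is never
      1.\<close>
    then have ne: "s / g s \<noteq> s * t s / g s"
      using dom(2)[OF s] \<open>s \<noteq> 0\<close> by simp
    note x_eqs = x1[OF s] x2[OF s] x3[OF s]
    show ?thesis
    proof (intro conjI exI ballI allI)
      show "isotropy_subgroup (x s) = Sigma_C C1 C2"
        by (rule isotropy_subgroup_two_clusters[OF part _ _ _ ne]) (auto intro: x_eqs)
      show "s * t s / g s \<noteq> s / g s" using ne by (rule not_sym)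
    qed (auto intro: x_eqs)
  qed
  show ?thesis
    using \<open>\<delta> > 0\<close> smooth_x smooth_g x_0 g_0 deriv equil sym by blast
qed

end
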